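(* Let $2\leq r\leq\infty$. There exists a constant $a\geq0$ such that $$\psi_s(x)\leq a|x|$$ for every $x\in\mathbb{F}_r$ and $s\in[-1,1]$. In fact, we may take $a=\frac{r}{r-1}$ when $r$ is finite, and we may take $a=1$ when $r=\infty$.
   Context: For $2\leq r\leq\infty$, $\mathbb{F}_r$ is the free group on $r$ generators (countably infinitely many if $r=\infty$), $e$ is its identity, and $|x|$ is the word length of $x\in\mathbb{F}_r$ with respect to the free generators. A function $\phi:\mathbb{F}_r\to\mathbb{C}$ is radial if $\phi(x)$ depends only on $|x|$; then $\phi(x)=\dot\phi(|x|)$ for a unique $\dot\phi:\mathbb{N}_0\to\mathbb{C}$. Spherical functions: for $s\in\mathbb{C}$, the spherical function $\phi_s$ on $\mathbb{F}_r$ with eigenvalue $s$ is the radial function defined as follows. If $r<\infty$, put $q=2r-1$; then $\phi_s$ is the unique radial function with $\phi_s(e)=1$ such that for every $x$ the average of $\phi_s$ over the $q+1$ neighbours of $x$ in the Cayley graph of $\mathbb{F}_r$ (with respect to the free generators) equals $s\phi_s(x)$. Equivalently, $\dot\phi_s(0)=1$, $\dot\phi_s(1)=s$, and $\dot\phi_s(n+1)=\frac{q+1}{q}s\,\dot\phi_s(n)-\frac1q\dot\phi_s(n-1)$ for $n\geq1$; explicitly, $$\dot\phi_s(n)=\left[\frac{2}{q+1}T_n\left(\frac{q+1}{2\sqrt q}s\right)+\frac{q-1}{q+1}U_n\left(\frac{q+1}{2\sqrt q}s\right)\right]q^{-n/2},\qquad n\in\mathbb{N}_0,$$ where $T_n$,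 $U_n$ are the Chebyshev polynomials of the first and second kind. If $r=\infty$, then $\phi_s(x)=s^{|x|}$ (with $0^0=1$). For $x\in\mathbb{F}_r$ define $\psi_s(x)=\dfrac{1-\phi_s(x)}{1-s}$ for $-1\leq s<1$ and $\psi_1(x)=\lim_{s\to1}\psi_s(x)$. For each fixed $x$, $\phi_s(x)$ is a real polynomial in $s$ with value $1$ at $s=1$, so the limit exists and $\psi_s(x)$ is real. *)

theory Defs
  imports "HOL-Analysis.Analysis" "HOL-Library.Extended_Nat" "HOL-Algebra.Group"
begin

section \<open>The free group on \<open>r\<close> generators\<close>

text \<open>
  The pair \<open>(i, True)\<close> is the \<open>i\<close>-th free generator and \<open>(i, False)\<close> is its inverse.
  The elements of the free group are the reduced words. The generators are indexed by the
  natural numbers below \<open>r\<close>, hence by all natural numbers if \<open>r = \<infinity>\<close>.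
\<close>

type_synonym letter = "nat \<times> bool"

fun linv :: "letter \<Rightarrow> letter" where
  "linv (i, b) = (i, \<not> b)"

definition letters :: "enat \<Rightarrow> letter set" where
  "letters r = {a. enat (fst a) < r}"

definition reduced :: "letter list \<Rightarrow> bool" where
  "reduced = successively (\<lambda>a b. b \<noteq> linv a)"

fun cons_red :: "letter \<Rightarrow> letter list \<Rightarrow> letter list" where
  "cons_red a [] = [a]"
| "cons_red a (b # w) = (if b = linv a then w else a # b # w)"

text \<open>For a reduced word \<open>v\<close>, \<open>foldr cons_red u v\<close> is the reduced form of \<open>u @ v\<close>.\<close>

definition free_group :: "enat \<Rightarrow> letter list monoid" where
  "free_group r =
     \<lparr>carrier = {w. set w \<subseteq> letters r \<and> reduced w}, mult = foldr cons_red, one = []\<rparr>"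

text \<open>
  The word length of an element is the length of the reduced word; see
  \<open>length_eq_Least\<close> below.
\<close>

definition neighbours :: "enat \<Rightarrow> letter list \<Rightarrow> letter list set" where
  "neighbours r x = (\<lambda>a. x \<otimes>\<^bsub>free_group r\<^esub> [a]) ` letters r"

section \<open>Spherical functions\<close>

definition radial :: "enat \<Rightarrow> (letter list \<Rightarrow> complex) \<Rightarrow> bool" where
  "radial r \<phi> \<longleftrightarrow>
     (\<forall>x\<in>carrier (free_group r). \<forall>y\<in>carrier (free_group r). length x = length y \<longrightarrow> \<phi> x = \<phi> y)"

text \<open>
  Functions on the free group are represented by functions that take the value
  \<^const>\<open>undefined\<close> outside its carrier, so that the uniqueness in the finite-rank case is
  meaningful; see \<open>ex1_is_spherical\<close> below.
\<close>

definition is_spherical :: "enat \<Rightarrow> complex \<Rightarrow> (letter list \<Rightarrow> complex) \<Rightarrow> bool" where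
  "is_spherical r s \<phi> \<longleftrightarrow>
     \<phi> \<in> extensional (carrier (free_group r)) \<and> radial r \<phi> \<and> \<phi> \<one>\<^bsub>free_group r\<^esub> = 1 \<and>
     (\<forall>x\<in>carrier (free_group r).
        (\<Sum>y\<in>neighbours r x. \<phi> y) / of_nat (card (neighbours r x)) = s * \<phi> x)"

definition spherical :: "enat \<Rightarrow> complex \<Rightarrow> letter list \<Rightarrow> complex" where
  "spherical r s =
     (if r = \<infinity> then restrict (\<lambda>x. s ^ length x) (carrier (free_group r))
      else THE \<phi>. is_spherical r s \<phi>)"

definition psi :: "enat \<Rightarrow> real \<Rightarrow> letter list \<Rightarrow> complex" where
  "psi r s x =
     (if s = 1
      then Lim (at_left (1::real)) (\<lambda>t. (1 - spherical r (of_real t) x) / (1 - of_real t))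
      else (1 - spherical r (of_real s) x) / (1 - of_real s))"

section \<open>Well-definedness\<close>

lemma linv_linv [simp]: "linv (linv a) = a"
  by (cases a) auto

lemma linv_neq [simp]: "linv a \<noteq> a" "a \<noteq> linv a"
  by (cases a; simp)+

lemma linv_inj [simp]: "linv a = linv b \<longleftrightarrow> a = b"
  by (metis linv_linv)

lemma fst_linv [simp]: "fst (linv a) = fst a"
  by (cases a) auto

lemma linv_in_letters [simp]: "linv a \<in> letters r \<longleftrightarrow> a \<in> letters r"
  by (simp add: letters_def)

lemma reduced_Nil [simp]: "reduced []"
  by (simp add: reduced_def)

lemma reduced_Cons: "reduced (a # w) \<longleftrightarrow> w = [] \<or> hd w \<noteq> linv a \<and> reduced w"
  by (simp add: reduced_def successively_Cons)

lemma reduced_cons_red: "reduced w \<Longrightarrow> reduced (cons_red a w)"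
  by (cases w) (auto simp: reduced_Cons)

lemma reduced_foldr: "reduced v \<Longrightarrow> reduced (foldr cons_red u v)"
  by (induction u) (auto intro: reduced_cons_red)

lemma set_cons_red: "set (cons_red a w) \<subseteq> insert a (set w)"
  by (cases w) auto

lemma set_foldr_cons_red: "set (foldr cons_red u v) \<subseteq> set u \<union> set v"
  by (induction u) (use set_cons_red in fastforce)+

lemma length_cons_red: "length (cons_red a w) \<le> Suc (length w)"
  by (cases w) auto

lemma length_foldr_cons_red: "length (foldr cons_red u v) \<le> length u + length v"
  by (induction u) (use length_cons_red le_trans in fastforce)+

lemma foldr_cons_red_Nil: "reduced w \<Longrightarrow> foldr cons_red w [] = w"
proof (induction w)
  case (Cons a w)
  then show ?case by (cases w) (auto simp: reduced_Cons)
qed auto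

lemma cons_red_linv: "reduced w \<Longrightarrow> cons_red a (cons_red (linv a) w) = w"
proof (cases w)
  case (Cons b v)
  assume "reduced w"
  then show ?thesis using Cons by (cases v) (auto simp: reduced_Cons)
qed auto

lemma foldr_cons_red_assoc:
  assumes "reduced v" "reduced w"
  shows "foldr cons_red (foldr cons_red u v) w = foldr cons_red u (foldr cons_red v w)"
proof (induction u)
  case (Cons a u)
  define z where "z = foldr cons_red u v"
  have "foldr cons_red (cons_red a z) w = cons_red a (foldr cons_red z w)"
  proof (cases z)
    case (Cons b z')
    then show ?thesis
      using cons_red_linv[OF reduced_foldr[OF assms(2)], of a z'] by auto
  qed auto
  then show ?case using Cons by (simp add: z_def)
qed auto

lemma foldr_linv_left: "reduced w \<Longrightarrow> foldr cons_red (map linv (rev u)) (foldr cons_red u w) = w"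
proof (induction u arbitrary: w)
  case (Cons a u)
  have "cons_red (linv a) (cons_red a (foldr cons_red u w)) = foldr cons_red u w"
    using cons_red_linv[OF reduced_foldr[OF Cons.prems], of "linv a" u] by simp
  then show ?case using Cons by simp
qed auto

lemma reduced_map_linv_rev: "reduced u \<Longrightarrow> reduced (map linv (rev u))"
  unfolding reduced_def successively_map successively_rev
  by (erule successively_mono) (metis linv_linv)

lemma group_free_group: "group (free_group r)"
proof (rule groupI)
  fix x y assume "x \<in> carrier (free_group r)" "y \<in> carrier (free_group r)"
  then show "x \<otimes>\<^bsub>free_group r\<^esub> y \<in> carrier (free_group r)"
    using set_foldr_cons_red[of x y] by (auto simp: free_group_def reduced_foldr)
next
  fix x assume x: "x \<in> carrier (free_group r)"
  have "map linv (rev x) \<in> carrier (free_group r)"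
    using x by (auto simp: free_group_def reduced_map_linv_rev letters_def)
  moreover have "map linv (rev x) \<otimes>\<^bsub>free_group r\<^esub> x = \<one>\<^bsub>free_group r\<^esub>"
    using foldr_linv_left[of "[]" x] x by (simp add: free_group_def foldr_cons_red_Nil)
  ultimately show "\<exists>y\<in>carrier (free_group r). y \<otimes>\<^bsub>free_group r\<^esub> x = \<one>\<^bsub>free_group r\<^esub>"
    by blast
qed (auto simp: free_group_def foldr_cons_red_assoc)

lemma length_eq_Least:
  assumes "x \<in> carrier (free_group r)"
  shows "length x =
    (LEAST n. \<exists>w. set w \<subseteq> letters r \<and> length w = n \<and>
       x = foldr (\<lambda>a y. [a] \<otimes>\<^bsub>free_group r\<^esub> y) w \<one>\<^bsub>free_group r\<^esub>)"
proof -
  have "foldr (\<lambda>a y. [a] \<otimes>\<^bsub>free_group r\<^esub> y) w \<one>\<^bsub>free_group r\<^esub> = foldr cons_red w []" for w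
    by (simp add: free_group_def)
  then show ?thesis
    using assms length_foldr_cons_red[of _ "[]"]
    by (intro Least_equality[symmetric])
       (auto simp: free_group_def foldr_cons_red_Nil intro!: exI[of _ x])
qed

lemma mult_letter:
  assumes "reduced x"
  shows "foldr cons_red x [a] = (if x \<noteq> [] \<and> last x = linv a then butlast x else x @ [a])"
  using assms
proof (induction x)
  case (Cons b x)
  show ?case
  proof (cases x)
    case Nil
    then show ?thesis by (cases a; cases b) auto
  next
    case x: (Cons c y)
    have ih: "foldr cons_red x [a] = (if last x = linv a then butlast x else x @ [a])"
      using Cons x by (simp add: reduced_Cons)
    have "c \<noteq> linv b" using Cons.prems x by (simp add: reduced_Cons)
    then show ?thesis using ih x by (cases y) auto
  qed
qed auto

lemma neighbours_Nil: "neighbours r [] = (\<lambda>a. [a]) ` letters r"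
  by (simp add: neighbours_def free_group_def)

lemma neighbours_snoc:
  assumes "x \<in> carrier (free_group r)" "x \<noteq> []"
  shows "neighbours r x =
    insert (butlast x) ((\<lambda>a. x @ [a]) ` (letters r - {linv (last x)}))"
proof -
  have "last x \<in> letters r" using assms by (auto simp: free_group_def)
  then have l: "letters r = insert (linv (last x)) (letters r - {linv (last x)})"
    by auto
  have "reduced x" using assms by (simp add: free_group_def)
  then have m: "x \<otimes>\<^bsub>free_group r\<^esub> [a] = (if a = linv (last x) then butlast x else x @ [a])" for a
    using assms(2) mult_letter[of x a] by (auto simp: free_group_def)
  show ?thesis
    unfolding neighbours_def by (subst l) (auto simp: m)
qed

lemma neighbours_carrier:
  assumes "x \<in> carrier (free_group r)"
  shows "neighbours r x \<subseteq> carrier (free_group r)"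
proof
  fix y assume "y \<in> neighbours r x"
  then obtain a where a: "a \<in> letters r" "y = x \<otimes>\<^bsub>free_group r\<^esub> [a]"
    by (auto simp: neighbours_def)
  have "[a] \<in> carrier (free_group r)" using a by (simp add: free_group_def reduced_Cons)
  then show "y \<in> carrier (free_group r)"
    using a assms group.is_monoid[OF group_free_group] by (simp add: monoid.m_closed)
qed

lemma letters_enat: "letters (enat n) = {..<n} \<times> UNIV"
  by (auto simp: letters_def)

lemma card_letters [simp]: "finite (letters (enat n))" "card (letters (enat n)) = 2 * n"
  by (auto simp: letters_enat card_cartesian_product)

lemma sum_neighbours_Nil:
  "(\<Sum>y\<in>neighbours (enat n) []. f (length y)) = of_nat (2 * n) * (f 1 :: complex)"
  unfolding neighbours_Nil by (subst sum.reindex) (auto simp: inj_on_def)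

lemma sum_neighbours:
  assumes "x \<in> carrier (free_group (enat n))" "x \<noteq> []"
  shows "(\<Sum>y\<in>neighbours (enat n) x. f (length y)) =
    f (length x - 1) + of_nat (2 * n - 1) * (f (length x + 1) :: complex)"
proof -
  have l: "linv (last x) \<in> letters (enat n)" using assms by (auto simp: free_group_def)
  have "butlast x \<notin> (\<lambda>a. x @ [a]) ` (letters (enat n) - {linv (last x)})"
    by (auto dest: arg_cong[where f = length])
  moreover have "(\<Sum>y\<in>(\<lambda>a. x @ [a]) ` (letters (enat n) - {linv (last x)}). f (length y)) =
      of_nat (2 * n - 1) * f (length x + 1)"
    by (subst sum.reindex) (use l in \<open>auto simp: inj_on_def\<close>)
  ultimately show ?thesis
    unfolding neighbours_snoc[OF assms] by (subst sum.insert) auto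
qed

lemma card_neighbours:
  assumes "x \<in> carrier (free_group (enat n))"
  shows "card (neighbours (enat n) x) = 2 * n"
proof (cases "x = []")
  case True
  then show ?thesis by (simp add: neighbours_Nil card_image inj_on_def)
next
  case False
  have "last x \<in> letters (enat n)" using assms False by (auto simp: free_group_def)
  then have "n > 0" by (auto simp: letters_enat)
  have "complex_of_nat (card (neighbours (enat n) x)) = of_nat (2 * n)"
    using sum_neighbours[OF assms False, of "\<lambda>_. 1"] \<open>n > 0\<close> by (simp add: of_nat_diff)
  then show ?thesis by (simp only: of_nat_eq_iff)
qed

lemma replicate_in_carrier:
  assumes "n > 0"
  shows "replicate k (0, True) \<in> carrier (free_group (enat n))"
  using assms by (induction k) (auto simp: free_group_def reduced_Cons letters_def zero_enat_def[symmetric])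

fun spherical_dot :: "nat \<Rightarrow> complex \<Rightarrow> nat \<Rightarrow> complex" where
  "spherical_dot n s 0 = 1"
| "spherical_dot n s (Suc 0) = s"
| "spherical_dot n s (Suc (Suc k)) =
     (of_nat (2 * n) * s * spherical_dot n s (Suc k) - spherical_dot n s k) / of_nat (2 * n - 1)"

lemma is_spherical_spherical_dot:
  assumes "n > 0"
  shows "is_spherical (enat n) s
    (restrict (\<lambda>x. spherical_dot n s (length x)) (carrier (free_group (enat n))))"
proof -
  let ?C = "carrier (free_group (enat n))"
  have "(\<Sum>y\<in>neighbours (enat n) x. restrict (\<lambda>x. spherical_dot n s (length x)) ?C y) /
      of_nat (card (neighbours (enat n) x)) = s * restrict (\<lambda>x. spherical_dot n s (length x)) ?C x"
    if x: "x \<in> ?C" for x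
  proof -
    have eq: "(\<Sum>y\<in>neighbours (enat n) x. restrict (\<lambda>x. spherical_dot n s (length x)) ?C y) =
        (\<Sum>y\<in>neighbours (enat n) x. spherical_dot n s (length y))"
      using neighbours_carrier[OF x] by (intro sum.cong) auto
    show ?thesis
    proof (cases "x = []")
      case True
      then show ?thesis
        unfolding eq card_neighbours[OF x] using x assms by (simp add: sum_neighbours_Nil)
    next
      case False
      then obtain k where k: "length x = Suc k" by (cases x) auto
      have "of_nat (2 * n - 1) \<noteq> (0::complex)" using assms unfolding of_nat_eq_0_iff by auto
      then show ?thesis
        unfolding eq card_neighbours[OF x] using x assms k False
        by (simp add: sum_neighbours)
    qed
  qed
  then show ?thesis by (auto simp: is_spherical_def radial_def free_group_def)
qed

lemma is_spherical_unique:
  assumes "n > 0" "is_spherical (enat n) s \<phi>" "x \<in> carrier (free_group (enat n))"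
  shows "\<phi> x = spherical_dot n s (length x)"
proof -
  let ?C = "carrier (free_group (enat n))"
  define f where "f k = \<phi> (replicate k (0, True))" for k
  have f: "\<phi> y = f (length y)" if "y \<in> ?C" for y
    using assms(2) that replicate_in_carrier[OF assms(1), of "length y"]
    unfolding is_spherical_def radial_def f_def by (metis length_replicate)
  have avg: "(\<Sum>y\<in>neighbours (enat n) x. f (length y)) / of_nat (2 * n) = s * f (length x)"
    if x: "x \<in> ?C" for x
  proof -
    have "(\<Sum>y\<in>neighbours (enat n) x. f (length y)) = (\<Sum>y\<in>neighbours (enat n) x. \<phi> y)"
      using neighbours_carrier[OF x] f by (intro sum.cong) auto
    then show ?thesis
      using assms(2) x unfolding is_spherical_def card_neighbours[OF x, symmetric] f[OF x, symmetric]
      by simp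
  qed
  have "f k = spherical_dot n s k" for k
  proof (induction k rule: induct_nat_012)
    case 0
    show ?case using assms(2) by (simp add: f_def is_spherical_def free_group_def)
  next
    case 1
    have "f 0 = 1" using assms(2) by (simp add: f_def is_spherical_def free_group_def)
    then show ?case
      using avg[of "[]"] replicate_in_carrier[OF assms(1), of 0] assms(1)
      by (simp add: sum_neighbours_Nil)
  next
    case (ge2 k)
    have nz: "of_nat (2 * n - 1) \<noteq> (0::complex)" "of_nat (2 * n) \<noteq> (0::complex)"
      using assms(1) unfolding of_nat_eq_0_iff by auto
    have "(f k + of_nat (2 * n - 1) * f (Suc (Suc k))) / of_nat (2 * n) = s * f (Suc k)"
      using avg[OF replicate_in_carrier[OF assms(1), of "Suc k"]]
        sum_neighbours[OF replicate_in_carrier[OF assms(1), of "Suc k"], of f] by simp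
    then have "f k + of_nat (2 * n - 1) * f (Suc (Suc k)) = s * f (Suc k) * of_nat (2 * n)"
      using nz by (simp only: divide_eq_eq if_False not_False_eq_True if_True)
    then have "f (Suc (Suc k)) = (of_nat (2 * n) * s * f (Suc k) - f k) / of_nat (2 * n - 1)"
      using nz by (simp only: eq_divide_eq if_False not_False_eq_True if_True) (simp only: algebra_simps)
    then show ?case using ge2 by simp
  qed
  then show ?thesis using f[OF assms(3)] by simp
qed

lemma ex1_is_spherical:
  assumes "n > 0"
  shows "\<exists>!\<phi>. is_spherical (enat n) s \<phi>"
proof (rule ex1I)
  show "is_spherical (enat n) s
    (restrict (\<lambda>x. spherical_dot n s (length x)) (carrier (free_group (enat n))))"
    by (rule is_spherical_spherical_dot[OF assms])
  fix \<phi> assume "is_spherical (enat n) s \<phi>"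
  then show "\<phi> = restrict (\<lambda>x. spherical_dot n s (length x)) (carrier (free_group (enat n)))"
    using is_spherical_unique[OF assms]
    by (intro extensionalityI[of _ "carrier (free_group (enat n))"]) (auto simp: is_spherical_def)
qed

lemma spherical_enat:
  assumes "n > 0" "x \<in> carrier (free_group (enat n))"
  shows "spherical (enat n) s x = spherical_dot n s (length x)"
  using is_spherical_unique[OF assms(1) theI'[OF ex1_is_spherical[OF assms(1)]] assms(2)]
  by (simp add: spherical_def)

end

theory Submission
  imports Defs
begin

text \<open>
  Write \<open>q = 2r - 1\<close> and let \<open>p\<^sub>n\<close> be the spherical function with eigenvalue \<open>s\<close> at length \<open>n\<close>.
  The slopes \<open>d\<^sub>n = (p\<^sub>n - p\<^sub>n\<^sub>+\<^sub>1) / (1 - s)\<close> are polynomials in \<open>s\<close>, and the three-term recurrence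
  becomes \<open>q d\<^sub>n\<^sub>+\<^sub>1 = d\<^sub>n + (q + 1) p\<^sub>n\<^sub>+\<^sub>1\<close>. Given \<open>p\<^sub>n \<le> 1\<close>, all slopes stay below the fixed point
  \<open>(q + 1) / (q - 1) = r / (r - 1)\<close> of \<open>d \<mapsto> (d + q + 1) / q\<close>, and \<open>\<psi>\<^sub>s\<close> at length \<open>n\<close> is the sum of
  the first \<open>n\<close> of them.

  For \<open>\<bar>p\<^sub>n\<bar> \<le> 1\<close>, put \<open>t = (q + 1) s / (2 \<surd>q)\<close>. If \<open>\<bar>t\<bar> < 1\<close>, use the Chebyshev formula with
  \<open>\<bar>T\<^sub>n\<bar> \<le> 1\<close> and \<open>\<bar>U\<^sub>n\<bar> \<le> n + 1\<close>. If \<open>t \<ge> 1\<close>, then \<open>q\<^sup>n\<^sup>/\<^sup>2 p\<^sub>n\<close> is nondecreasing, so \<open>p\<^sub>n > 0\<close>, so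
  the slopes are nonnegative and \<open>p\<^sub>n\<close> decreases from \<open>1\<close>. The case \<open>t \<le> -1\<close> follows by parity.
\<close>

section \<open>Real spherical functions and their slopes\<close>

text \<open>A real counterpart of \<open>spherical_dot\<close>: the order of the reals is available,
  and a real parameter \<open>q\<close> can later be written as \<open>w\<^sup>2\<close>.\<close>

fun sph :: "real \<Rightarrow> real \<Rightarrow> nat \<Rightarrow> real" where
  "sph q s 0 = 1"
| "sph q s (Suc 0) = s"
| "sph q s (Suc (Suc k)) = ((q + 1) * s * sph q s (Suc k) - sph q s k) / q"

text \<open>Given by a recurrence instead of a quotient by \<open>1 - s\<close>, so that it also
  makes sense, and is continuous, at \<open>s = 1\<close>.\<close>

fun slope :: "real \<Rightarrow> real \<Rightarrow> nat \<Rightarrow> real" where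
  "slope q s 0 = 1"
| "slope q s (Suc k) = (slope q s k + (q + 1) * sph q s (Suc k)) / q"

lemma spherical_dot_of_real:
  assumes "n > 0"
  shows "spherical_dot n (of_real s) k = of_real (sph (real (2 * n - 1)) s k)"
proof -
  \<comment> \<open>As \<open>n > 0\<close>, the subtraction on the naturals is exact, and
    \<open>q + 1\<close> becomes the coefficient \<open>2 * n\<close> of
    \<open>spherical_dot\<close>.\<close>
  have "real (2 * n - 1) + 1 = real (2 * n)"
    using assms by (simp add: of_nat_diff)
  then show ?thesis
    by (induction k rule: induct_nat_012) simp_all
qed

text \<open>The recurrence rearranges to \<open>q (p\<^sub>k\<^sub>+\<^sub>1 -
  p\<^sub>k\<^sub>+\<^sub>2) = (p\<^sub>k - p\<^sub>k\<^sub>+\<^sub>1) + (q + 1) (1 - s)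
  p\<^sub>k\<^sub>+\<^sub>1\<close>, from which \<open>1 - s\<close> factors out by
  induction.\<close>

lemma sph_diff:
  assumes "q \<noteq> 0"
  shows "sph q s k - sph q s (Suc k) = (1 - s) * slope q s k"
proof (induction k)
  case (Suc k)
  have "q * sph q s (Suc (Suc k)) = (q + 1) * s * sph q s (Suc k) - sph q s k"
    using assms by simp
  moreover have "q * slope q s (Suc k) = slope q s k + (q + 1) * sph q s (Suc k)"
    using assms by simp
  ultimately have "q * (sph q s (Suc k) - sph q s (Suc (Suc k))) = q * ((1 - s) * slope q s (Suc k))"
    using Suc by algebra
  then show ?case using assms by (simp only: mult_cancel_left) simp
qed simp

lemma one_minus_sph:
  assumes "q \<noteq> 0"
  shows "1 - sph q s k = (1 - s) * (\<Sum>j<k. slope q s j)"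
  using sum_lessThan_telescope'[of "sph q s" k]
  by (simp add: sph_diff[OF assms] sum_distrib_left)

lemma sph_minus: "sph q (- s) k = (-1) ^ k * sph q s k"
  by (induction k rule: induct_nat_012) (simp_all add: field_simps)

lemma abs_sph_minus: "\<bar>sph q (- s) k\<bar> = \<bar>sph q s k\<bar>"
  by (simp add: sph_minus abs_mult power_abs)

section \<open>Spherical functions are bounded by 1\<close>

text \<open>This is the bound n + 1 on the Chebyshev polynomial U_n at cos \<theta>, cleared of its
  denominator sin \<theta>.\<close>

lemma abs_sin_Suc_mult_le: "\<bar>sin (real (Suc n) * \<theta>)\<bar> \<le> real (Suc n) * \<bar>sin \<theta>\<bar>"
proof (induction n)
  case (Suc n)
  have "real (Suc (Suc n)) * \<theta> = real (Suc n) * \<theta> + \<theta>"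
    by (simp add: algebra_simps)
  then have "sin (real (Suc (Suc n)) * \<theta>) =
      sin (real (Suc n) * \<theta>) * cos \<theta> + cos (real (Suc n) * \<theta>) * sin \<theta>"
    by (simp only: sin_add)
  also have "\<bar>\<dots>\<bar> \<le> \<bar>sin (real (Suc n) * \<theta>)\<bar> * 1 + 1 * \<bar>sin \<theta>\<bar>"
    by (intro order_trans[OF abs_triangle_ineq] add_mono)
       (auto simp: abs_mult mult_left_le mult_left_le_one_le)
  finally show ?case using Suc by (simp add: algebra_simps)
qed simp

text \<open>The explicit formula with \<open>w\<close> in the role of \<surd>q, multiplied by
  \<open>(q + 1) * sin \<theta>\<close> to avoid division. Both sides satisfy
  \<open>x\<^sub>n\<^sub>+\<^sub>2 = 2 cos \<theta> x\<^sub>n\<^sub>+\<^sub>1 -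
  x\<^sub>n\<close>.\<close>

lemma sph_eq_Chebyshev:
  assumes w: "w \<noteq> 0" and s: "(w\<^sup>2 + 1) * s = 2 * w * cos \<theta>"
  shows "(w\<^sup>2 + 1) * w ^ n * sph (w\<^sup>2) s n * sin \<theta> =
    2 * cos (real n * \<theta>) * sin \<theta> + (w\<^sup>2 - 1) * sin (real (Suc n) * \<theta>)"
proof (induction n rule: induct_nat_012)
  case 0
  show ?case by (simp add: algebra_simps)
next
  case 1
  have "(w\<^sup>2 + 1) * w * s * sin \<theta> = 2 * cos \<theta> * sin \<theta> + (w\<^sup>2 - 1) * (2 * sin \<theta> * cos \<theta>)"
    using s by algebra
  then show ?case using sin_double[of \<theta>] by simp
next
  case (ge2 n)
  have "w\<^sup>2 * sph (w\<^sup>2) s (Suc (Suc n)) = 2 * w * cos \<theta> * sph (w\<^sup>2) s (Suc n) - sph (w\<^sup>2) s n"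
    using w s by simp
  from arg_cong[OF this, of "\<lambda>z. w ^ n * z"] have p: "w ^ Suc (Suc n) * sph (w\<^sup>2) s (Suc (Suc n)) =
      2 * cos \<theta> * (w ^ Suc n * sph (w\<^sup>2) s (Suc n)) - w ^ n * sph (w\<^sup>2) s n"
    by (simp only: power_Suc power2_eq_square algebra_simps)
  have c: "cos (x + \<theta> + \<theta>) = 2 * cos \<theta> * cos (x + \<theta>) - cos x"
    and si: "sin (x + \<theta> + \<theta>) = 2 * cos \<theta> * sin (x + \<theta>) - sin x" for x
    using cos_diff[of "x + \<theta>" \<theta>] cos_add[of "x + \<theta>" \<theta>]
      sin_diff[of "x + \<theta>" \<theta>] sin_add[of "x + \<theta>" \<theta>] by simp_all
  have "cos (real (Suc (Suc n)) * \<theta>) = 2 * cos \<theta> * cos (real (Suc n) * \<theta>) - cos (real n * \<theta>)"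
    "sin (real (Suc (Suc (Suc n))) * \<theta>) =
      2 * cos \<theta> * sin (real (Suc (Suc n)) * \<theta>) - sin (real (Suc n) * \<theta>)"
    using c[of "real n * \<theta>"] si[of "real (Suc n) * \<theta>"] by (simp_all add: algebra_simps)
  note trig = this
  have "(w\<^sup>2 + 1) * w ^ Suc (Suc n) * sph (w\<^sup>2) s (Suc (Suc n)) * sin \<theta> =
      (w\<^sup>2 + 1) * (w ^ Suc (Suc n) * sph (w\<^sup>2) s (Suc (Suc n))) * sin \<theta>"
    by (simp only: mult.assoc)
  also have "\<dots> = 2 * cos \<theta> * ((w\<^sup>2 + 1) * w ^ Suc n * sph (w\<^sup>2) s (Suc n) * sin \<theta>) -
      (w\<^sup>2 + 1) * w ^ n * sph (w\<^sup>2) s n * sin \<theta>"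
    unfolding p by (simp only: algebra_simps)
  also have "\<dots> = 2 * cos (real (Suc (Suc n)) * \<theta>) * sin \<theta> +
      (w\<^sup>2 - 1) * sin (real (Suc (Suc (Suc n))) * \<theta>)"
    unfolding ge2 trig by (simp only: algebra_simps)
  finally show ?case .
qed

text \<open>The left side is what the bounds on T_n and U_n give, the right side the factor in front
  of \<open>sph\<close>. They agree at \<open>n = 0\<close>; the increments are
  \<open>(w - 1) * (w + 1)\<close> and \<open>(w - 1) * ((w\<^sup>2 + 1) * w ^ n)\<close>.\<close>

lemma linear_le_power:
  fixes w :: real
  assumes "w \<ge> 1"
  shows "2 + (w\<^sup>2 - 1) * real (Suc n) \<le> (w\<^sup>2 + 1) * w ^ n"
proof (induction n)
  case (Suc n)
  have "w + 1 \<le> (w\<^sup>2 + 1) * 1"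
    using mult_right_mono[OF assms, of w] assms by (simp add: power2_eq_square)
  also have "\<dots> \<le> (w\<^sup>2 + 1) * w ^ n"
    using assms by (intro mult_left_mono) (auto simp: one_le_power)
  finally have "(w - 1) * (w + 1) \<le> (w - 1) * ((w\<^sup>2 + 1) * w ^ n)"
    using assms by (intro mult_left_mono) auto
  then show ?case using Suc by (simp add: algebra_simps power2_eq_square)
qed simp

lemma abs_sph_le_1_elliptic:
  assumes w: "w \<ge> 1" and s: "\<bar>(w\<^sup>2 + 1) * s\<bar> < 2 * w"
  shows "\<bar>sph (w\<^sup>2) s n\<bar> \<le> 1"
proof -
  define t where "t = (w\<^sup>2 + 1) * s / (2 * w)"
  define \<theta> where "\<theta> = arccos t"
  have t: "\<bar>t\<bar> < 1" using s w by (simp add: t_def abs_divide)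
  then have "cos \<theta> = t" "sin \<theta> \<noteq> 0"
    by (auto simp: \<theta>_def arccos sin_arccos_nonzero)
  then have "(w\<^sup>2 + 1) * s = 2 * w * cos \<theta>" using w by (simp add: t_def)
  from sph_eq_Chebyshev[OF _ this, of n] w
  have eq: "(w\<^sup>2 + 1) * w ^ n * sph (w\<^sup>2) s n * sin \<theta> =
      2 * cos (real n * \<theta>) * sin \<theta> + (w\<^sup>2 - 1) * sin (real (Suc n) * \<theta>)" by simp
  have "w\<^sup>2 \<ge> 1" using w by (simp add: one_le_power)
  have pos: "(w\<^sup>2 + 1) * w ^ n > 0" using w by (intro mult_pos_pos) (auto simp: add_nonneg_pos)
  have "(w\<^sup>2 + 1) * w ^ n * \<bar>sph (w\<^sup>2) s n\<bar> * \<bar>sin \<theta>\<bar> =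
      \<bar>2 * cos (real n * \<theta>) * sin \<theta> + (w\<^sup>2 - 1) * sin (real (Suc n) * \<theta>)\<bar>"
    unfolding eq[symmetric] abs_mult[of "_ * _" "sin \<theta>"] abs_mult[of "_ * _" "sph _ _ _"] abs_of_pos[OF pos] ..
  also have "\<dots> \<le> 2 * 1 * \<bar>sin \<theta>\<bar> + (w\<^sup>2 - 1) * (real (Suc n) * \<bar>sin \<theta>\<bar>)"
    using \<open>w\<^sup>2 \<ge> 1\<close> abs_sin_Suc_mult_le[of n \<theta>]
    by (intro order_trans[OF abs_triangle_ineq] add_mono)
       (auto simp only: abs_mult abs_of_nonneg intro!: mult_mono, auto)
  also have "\<dots> = (2 + (w\<^sup>2 - 1) * real (Suc n)) * \<bar>sin \<theta>\<bar>" by (simp add: algebra_simps)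
  also have "\<dots> \<le> (w\<^sup>2 + 1) * w ^ n * \<bar>sin \<theta>\<bar>"
    by (intro mult_right_mono linear_le_power[OF w]) auto
  finally have "(w\<^sup>2 + 1) * w ^ n * \<bar>sph (w\<^sup>2) s n\<bar> \<le> (w\<^sup>2 + 1) * w ^ n * 1"
    using \<open>sin \<theta> \<noteq> 0\<close> unfolding mult_1_right by (elim mult_right_le_imp_le) simp
  then show ?thesis using pos by (simp only: mult_le_cancel_left_pos)
qed

text \<open>For \<open>x\<^sub>n = w ^ n * sph (w\<^sup>2) s n\<close> the recurrence reads
  \<open>x\<^sub>n\<^sub>+\<^sub>2 = 2 t x\<^sub>n\<^sub>+\<^sub>1 - x\<^sub>n\<close> with t \<ge>
  1. While the terms are positive, each increment is at least the previous one.\<close>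

lemma sph_pos_hyperbolic:
  assumes w: "w \<ge> 1" and s: "(w\<^sup>2 + 1) * s \<ge> 2 * w"
  shows "sph (w\<^sup>2) s n > 0"
proof -
  have inc: "w ^ n * sph (w\<^sup>2) s n \<ge> 1 \<and> w ^ Suc n * sph (w\<^sup>2) s (Suc n) \<ge> w ^ n * sph (w\<^sup>2) s n"
  proof (induction n)
    case 0
    have "w\<^sup>2 \<ge> 1" using w by (simp add: one_le_power)
    \<comment> \<open>The first increment is \<open>w * s - 1\<close>; it is nonnegative because
      \<open>2 * w\<^sup>2\<close> dominates \<open>w\<^sup>2 + 1\<close>.\<close>
    have "(w\<^sup>2 + 1) * 1 \<le> w * (2 * w)"
      using \<open>w\<^sup>2 \<ge> 1\<close> by (simp add: power2_eq_square)
    also have "\<dots> \<le> w * ((w\<^sup>2 + 1) * s)" using w s by (intro mult_left_mono) auto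
    finally have "(w\<^sup>2 + 1) * 1 \<le> (w\<^sup>2 + 1) * (w * s)" by (simp add: algebra_simps)
    then have "1 \<le> w * s" using \<open>w\<^sup>2 \<ge> 1\<close> by (subst (asm) mult_le_cancel_left_pos) auto
    then show ?case by simp
  next
    case (Suc n)
    have p: "w ^ Suc n * sph (w\<^sup>2) s (Suc n) \<ge> 1" using Suc by linarith
    have "w ^ Suc n * sph (w\<^sup>2) s (Suc n) * (2 * w) \<le> w ^ Suc n * sph (w\<^sup>2) s (Suc n) * ((w\<^sup>2 + 1) * s)"
      using p s by (intro mult_left_mono) auto
    moreover have "w\<^sup>2 * sph (w\<^sup>2) s (Suc (Suc n)) =
        (w\<^sup>2 + 1) * s * sph (w\<^sup>2) s (Suc n) - sph (w\<^sup>2) s n"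
      using w by simp
    from arg_cong[OF this, of "\<lambda>z. w ^ Suc n * z"] have "w * (w ^ Suc (Suc n) * sph (w\<^sup>2) s (Suc (Suc n))) =
        w ^ Suc n * sph (w\<^sup>2) s (Suc n) * ((w\<^sup>2 + 1) * s) - w * (w ^ n * sph (w\<^sup>2) s n)"
      by (simp only: power_Suc power2_eq_square algebra_simps)
    moreover have "w * (w ^ n * sph (w\<^sup>2) s n) \<le> w * (w ^ Suc n * sph (w\<^sup>2) s (Suc n))"
      using Suc w by (intro mult_left_mono) auto
    ultimately have "w * (w ^ Suc n * sph (w\<^sup>2) s (Suc n)) \<le>
        w * (w ^ Suc (Suc n) * sph (w\<^sup>2) s (Suc (Suc n)))"
      by argo
    then have "w ^ Suc n * sph (w\<^sup>2) s (Suc n) \<le> w ^ Suc (Suc n) * sph (w\<^sup>2) s (Suc (Suc n))"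
      using w by (elim mult_left_le_imp_le) linarith
    then show ?case using p by blast
  qed
  then have "0 < w ^ n * sph (w\<^sup>2) s n" by linarith
  then show ?thesis using w by (simp add: zero_less_mult_iff)
qed

lemma abs_sph_le_1_hyperbolic:
  assumes w: "w \<ge> 1" and s: "(w\<^sup>2 + 1) * s \<ge> 2 * w" and "s \<le> 1"
  shows "\<bar>sph (w\<^sup>2) s n\<bar> \<le> 1"
proof -
  have pos: "sph (w\<^sup>2) s k > 0" for k
    by (rule sph_pos_hyperbolic[OF w s])
  have "slope (w\<^sup>2) s k \<ge> 0" for k
  proof (induction k)
    case (Suc k)
    then show ?case using pos[of "Suc k"] by (auto intro!: divide_nonneg_nonneg add_nonneg_nonneg)
  qed simp
  then have "0 \<le> (1 - s) * (\<Sum>j<n. slope (w\<^sup>2) s j)"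
    using \<open>s \<le> 1\<close> by (auto intro!: mult_nonneg_nonneg sum_nonneg)
  then show ?thesis
    using one_minus_sph[of "w\<^sup>2" s n] w pos[of n] by simp
qed

lemma abs_sph_le_1:
  assumes q: "q \<ge> 1" and s: "s \<in> {-1..1}"
  shows "\<bar>sph q s n\<bar> \<le> 1"
proof -
  define w where "w = sqrt q"
  have w: "w \<ge> 1" "w\<^sup>2 = q" using q by (auto simp: w_def)
  consider "\<bar>(w\<^sup>2 + 1) * s\<bar> < 2 * w" | "(w\<^sup>2 + 1) * s \<ge> 2 * w" | "(w\<^sup>2 + 1) * (- s) \<ge> 2 * w"
    by fastforce
  then show ?thesis
  proof cases
    case 1
    then show ?thesis using abs_sph_le_1_elliptic w by metis
  next
    case 2
    then show ?thesis using abs_sph_le_1_hyperbolic[OF w(1) 2] w s by simp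
  next
    case 3
    \<comment> \<open>The bound \<open>- s \<le> 1\<close> needed here is the lower bound on
      \<open>s\<close>.\<close>
    then show ?thesis
      using abs_sph_le_1_hyperbolic[OF w(1) 3, of n] w s by (simp add: abs_sph_minus)
  qed
qed

section \<open>Bounds on the slopes and on \<open>psi\<close>\<close>

lemma slope_le:
  assumes q: "q > 1" and s: "s \<in> {-1..1}"
  shows "slope q s k \<le> (q + 1) / (q - 1)"
proof (induction k)
  case 0
  show ?case using q by simp
next
  case (Suc k)
  have "sph q s (Suc k) \<le> 1" using abs_sph_le_1[of q s "Suc k"] q s by simp
  then have "(q + 1) * sph q s (Suc k) \<le> q + 1"
    using q mult_left_mono[of _ 1 "q + 1"] by simp
  then have "slope q s (Suc k) \<le> ((q + 1) / (q - 1) + (q + 1)) / q"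
    unfolding slope.simps using Suc q by (intro divide_right_mono add_mono) auto
  also have "\<dots> = (q + 1) / (q - 1)" using q by (simp add: field_simps)
  finally show ?case .
qed

lemma continuous_on_sph: "continuous_on A (\<lambda>s. sph q s k)"
  by (induction k rule: induct_nat_012) (auto simp: divide_inverse intro!: continuous_intros)

lemma continuous_on_slope: "continuous_on A (\<lambda>s. slope q s k)"
  by (induction k) (auto simp: divide_inverse simp del: sph.simps intro!: continuous_intros continuous_on_sph)

text \<open>Away from 1 the factor \<open>1 - t\<close> cancels; at 1, continuity of
  \<open>g\<close> identifies the left-hand limit. Each rank then only has to supply its
  \<open>g\<close>.\<close>

lemma psi_eqI:
  fixes g :: "real \<Rightarrow> real"
  assumes eq: "\<And>t. 1 - spherical r (of_real t) x = of_real ((1 - t) * g t)"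
    and cont: "continuous_on UNIV g"
  shows "psi r s x = of_real (g s)"
proof -
  have quot: "(1 - spherical r (of_real t) x) / (1 - of_real t) = complex_of_real (g t)" if "t \<noteq> 1" for t
  proof -
    have "1 - complex_of_real t \<noteq> 0" using that by simp
    then show ?thesis unfolding eq by simp
  qed
  have "(g \<longlongrightarrow> g 1) (at_left 1)"
    using cont by (auto simp: continuous_on_def intro: tendsto_within_subset)
  then have "((\<lambda>t. complex_of_real (g t)) \<longlongrightarrow> of_real (g 1)) (at_left 1)"
    by (rule tendsto_of_real)
  moreover have "\<forall>\<^sub>F t in at_left 1.
      complex_of_real (g t) = (1 - spherical r (of_real t) x) / (1 - of_real t)"
    unfolding eventually_at_filter by (auto simp: quot)
  ultimately have "((\<lambda>t. (1 - spherical r (of_real t) x) / (1 - of_real t)) \<longlongrightarrow>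
      complex_of_real (g 1)) (at_left 1)"
    by (rule Lim_transform_eventually)
  then have "Lim (at_left 1) (\<lambda>t. (1 - spherical r (of_real t) x) / (1 - of_real t)) =
      complex_of_real (g 1)"
    by (intro tendsto_Lim) auto
  then show ?thesis by (auto simp: psi_def quot)
qed

lemma psi_enat_bound:
  assumes n: "n \<ge> 2" and x: "x \<in> carrier (free_group (enat n))" and s: "s \<in> {-1..1}"
  shows "psi (enat n) s x \<in> \<real> \<and> Re (psi (enat n) s x) \<le> real n / (real n - 1) * real (length x)"
proof -
  define q where "q = real (2 * n - 1)"
  have q: "q > 1" "q = 2 * real n - 1" using n by (auto simp: q_def of_nat_diff)
  have "psi (enat n) s x = of_real (\<Sum>j<length x. slope q s j)"
  proof (rule psi_eqI)
    show "continuous_on UNIV (\<lambda>t. \<Sum>j<length x. slope q t j)"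
      by (intro continuous_on_sum continuous_on_slope)
    show "1 - spherical (enat n) (of_real t) x = of_real ((1 - t) * (\<Sum>j<length x. slope q t j))" for t
    proof -
      have "1 - spherical (enat n) (of_real t) x = of_real (1 - sph q t (length x))"
        using n x by (simp add: spherical_enat spherical_dot_of_real q_def)
      then show ?thesis using q by (simp only: one_minus_sph)
    qed
  qed
  moreover have "(\<Sum>j<length x. slope q s j) \<le> real (length x) * ((q + 1) / (q - 1))"
    using sum_bounded_above[of "{..<length x}" "slope q s", OF slope_le[OF q(1) s]] by simp
  \<comment> \<open>Both sides equal 2n / (2n - 2).\<close>
  moreover have "(q + 1) / (q - 1) = real n / (real n - 1)"
    using n by (simp add: q field_simps)
  ultimately show ?thesis by (simp add: mult.commute)
qed

lemma psi_infinity_bound: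
  assumes x: "x \<in> carrier (free_group \<infinity>)" and s: "s \<in> {-1..1}"
  shows "psi \<infinity> s x \<in> \<real> \<and> Re (psi \<infinity> s x) \<le> real (length x)"
proof -
  \<comment> \<open>In infinite rank the quotient is a geometric sum, whose \<open>length x\<close>
    terms are each at most 1.\<close>
  have "psi \<infinity> s x = of_real (\<Sum>j<length x. s ^ j)"
  proof (rule psi_eqI)
    show "continuous_on UNIV (\<lambda>t::real. \<Sum>j<length x. t ^ j)"
      by (intro continuous_intros)
    show "1 - spherical \<infinity> (of_real t) x = of_real ((1 - t) * (\<Sum>j<length x. t ^ j))" for t
      using x by (simp add: spherical_def one_diff_power_eq[symmetric] del: of_real_mult of_real_sum)
  qed
  moreover have "s ^ j \<le> 1" for j
  proof -
    have "\<bar>s ^ j\<bar> \<le> 1" unfolding power_abs using s by (intro power_le_one) auto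
    then show ?thesis by simp
  qed
  then have "(\<Sum>j<length x. s ^ j) \<le> real (length x)"
    using sum_bounded_above[of "{..<length x}" "\<lambda>j. s ^ j" 1] by simp
  ultimately show ?thesis by simp
qed

theorem proposition5p4:
  fixes r :: enat
  assumes "2 \<le> r"
  shows "(\<exists>a::real. a \<ge> 0 \<and>
            (\<forall>x\<in>carrier (free_group r). \<forall>s\<in>{-1..1}.
               psi r s x \<in> \<real> \<and> Re (psi r s x) \<le> a * real (length x))) \<and>
         (\<forall>n::nat. r = enat n \<longrightarrow>
            (\<forall>x\<in>carrier (free_group r). \<forall>s\<in>{-1..1}.
               psi r s x \<in> \<real> \<and>
               Re (psi r s x) \<le> real n / (real n - 1) * real (length x))) \<and>
         (r = \<infinity> \<longrightarrow>
            (\<forall>x\<in>carrier (free_group r). \<forall>s\<in>{-1..1}.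
               psi r s x \<in> \<real> \<and> Re (psi r s x) \<le> 1 * real (length x)))"
proof (cases r)
  case (enat n)
  then have "n \<ge> 2" using assms by (simp add: numeral_eq_enat)
  then have "\<forall>x\<in>carrier (free_group r). \<forall>s\<in>{-1..1}.
      psi r s x \<in> \<real> \<and> Re (psi r s x) \<le> real n / (real n - 1) * real (length x)"
    unfolding enat by (intro ballI psi_enat_bound)
  \<comment> \<open>The explicit constant is also the witness for the existence claim.\<close>
  moreover have "real n / (real n - 1) \<ge> 0" using \<open>n \<ge> 2\<close> by simp
  ultimately show ?thesis using enat by blast
next
  case infinity
  then have "\<forall>x\<in>carrier (free_group r). \<forall>s\<in>{-1..1}.
      psi r s x \<in> \<real> \<and> Re (psi r s x) \<le> 1 * real (length x)"
    using psi_infinity_bound by simp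
  then show ?thesis using infinity zero_le_one by blast
qed

end
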